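(* Let $\mathcal{H}$ be a complex Hilbert space, let $A_1,A_2,B_1,B_2,X_1,X_2\in\mathcal{B}(\mathcal{H})$, and let $\mathbb{A}=\begin{bmatrix}0&A_1\\ A_2&0\end{bmatrix}$, $\mathbb{B}=\begin{bmatrix}0&B_1\\ B_2&0\end{bmatrix}$ and $\mathbb{Y}=\begin{bmatrix}0&X_1\\ X_2&0\end{bmatrix}$ in $\mathcal{B}(\mathcal{H}\oplus\mathcal{H})$. Then $$\omega^{r}\left(|\mathbb{A}|^{\alpha}\mathbb{Y}|\mathbb{B}|^{\alpha}\right)\le\max\left\{\|X_1\|^r,\|X_2\|^r\right\}\max\left\{\left\|\tfrac1p|A_1|^{pr}+\tfrac1q|B_1|^{qr}\right\|^{\alpha},\left\|\tfrac1p|A_2|^{pr}+\tfrac1q|B_2|^{qr}\right\|^{\alpha}\right\}$$ for all $\alpha\in[0,1]$, $r\ge1$ and $p,q\ge1$ with $\frac1p+\frac1q=1$ and $pr,qr\ge2$.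
   Context: $\mathcal{B}(\cdot)$ denotes the algebra of bounded linear operators on a Hilbert space and $\|\cdot\|$ the operator norm. The numerical radius of a bounded operator $A$ on a complex Hilbert space is $\omega(A)=\sup_{\|x\|=1}|\langle Ax,x\rangle|$, and $\omega^s(A)=(\omega(A))^s$. $|A|=(A^*A)^{1/2}$; powers of positive operators are defined by the continuous functional calculus. *)

theory Defs
  imports "HOL-Analysis.Analysis" "HOL-Computational_Algebra.Polynomial"
begin

text \<open>
  A complex Hilbert space is a complete real inner product space with a complex scalar
  multiplication extending the real one and a complex inner product whose real part is the real
  inner product. Hence the library's norm is \<open>sqrt (Re (cinner x x))\<close>, and every complex Hilbert
  space arises in this way. The inner product is linear in its first argument.
\<close>

class complex_hilbert_space = real_inner + banach +
  fixes scaleC :: "complex \<Rightarrow> 'a \<Rightarrow> 'a"  (infixr "*\<^sub>C" 75)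
    and cinner :: "'a \<Rightarrow> 'a \<Rightarrow> complex"
  assumes scaleC_add_right: "a *\<^sub>C (x + y) = a *\<^sub>C x + a *\<^sub>C y"
    and scaleC_add_left: "(a + b) *\<^sub>C x = a *\<^sub>C x + b *\<^sub>C x"
    and scaleC_scaleC: "a *\<^sub>C (b *\<^sub>C x) = (a * b) *\<^sub>C x"
    and scaleR_scaleC: "s *\<^sub>R x = complex_of_real s *\<^sub>C x"
    and cinner_commute: "cinner x y = cnj (cinner y x)"
    and cinner_add_left: "cinner (x + y) z = cinner x z + cinner y z"
    and cinner_scaleC_left: "cinner (a *\<^sub>C x) y = a * cinner x y"
    and inner_eq_Re_cinner: "inner x y = Re (cinner x y)"

instantiation complex :: complex_hilbert_space
begin

definition scaleC_complex_def: "a *\<^sub>C (x :: complex) = a * x"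

definition cinner_complex_def: "cinner x (y :: complex) = x * cnj y"

instance
  by standard
    (simp_all add: scaleC_complex_def cinner_complex_def inner_complex_def scaleR_conv_of_real
      algebra_simps)

end

text \<open>The Hilbert space direct sum of two spaces; the library's norm on pairs is already the
  \<open>\<ell>\<^sup>2\<close> norm.\<close>

instantiation prod :: (complex_hilbert_space, complex_hilbert_space) complex_hilbert_space
begin

definition scaleC_prod_def: "a *\<^sub>C (z :: 'a \<times> 'b) = (a *\<^sub>C fst z, a *\<^sub>C snd z)"

definition cinner_prod_def:
  "cinner (z :: 'a \<times> 'b) w = cinner (fst z) (fst w) + cinner (snd z) (snd w)"

instance
proof
  fix x y :: "'a \<times> 'b"
  show "cinner x y = cnj (cinner y x)"
    using cinner_commute[of "fst x" "fst y"] cinner_commute[of "snd x" "snd y"]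
    by (simp add: cinner_prod_def)
qed (auto simp: scaleC_prod_def cinner_prod_def scaleC_add_right scaleC_add_left scaleC_scaleC
      scaleR_scaleC cinner_add_left cinner_scaleC_left inner_eq_Re_cinner inner_prod_def
      scaleR_prod_def prod_eq_iff distrib_left)

end

lemma norm_scaleC: "norm (a *\<^sub>C x) = cmod a * norm x"
  for x :: "'a::complex_hilbert_space"
proof -
  have r: "cinner x (a *\<^sub>C y) = cnj a * cinner x y" for x y :: 'a
    using cinner_commute[of x "a *\<^sub>C y"] cinner_commute[of y x]
    by (simp add: cinner_scaleC_left)
  have "cinner (a *\<^sub>C x) (a *\<^sub>C x) = complex_of_real ((cmod a)\<^sup>2) * cinner x x"
    by (simp add: cinner_scaleC_left r complex_norm_square mult.assoc del: of_real_power)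
  then have "inner (a *\<^sub>C x) (a *\<^sub>C x) = (cmod a)\<^sup>2 * inner x x"
    unfolding inner_eq_Re_cinner by (simp del: of_real_power)
  then have "(norm (a *\<^sub>C x))\<^sup>2 = (cmod a * norm x)\<^sup>2"
    by (simp add: power2_norm_eq_inner power_mult_distrib)
  then show ?thesis
    by (simp add: power2_eq_iff_nonneg)
qed

lemma bounded_linear_scaleC: "bounded_linear (\<lambda>x :: 'a::complex_hilbert_space. a *\<^sub>C x)"
proof (rule bounded_linear_intro[where K = "cmod a"])
  fix s and x :: 'a
  show "a *\<^sub>C (s *\<^sub>R x) = s *\<^sub>R (a *\<^sub>C x)"
    by (simp add: scaleR_scaleC scaleC_scaleC mult.commute)
qed (simp_all add: scaleC_add_right norm_scaleC mult.commute)

text \<open>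
  Elements of \<open>\<B>(H)\<close> are the complex-linear elements of the library type of bounded real-linear
  operators. This type provides the operator norm, the norm topology and the linear structure.
\<close>

definition complex_linear :: "('a::complex_hilbert_space \<Rightarrow>\<^sub>L 'b::complex_hilbert_space) \<Rightarrow> bool"
  where "complex_linear A \<longleftrightarrow> (\<forall>c x. A (c *\<^sub>C x) = c *\<^sub>C A x)"

lift_definition scalar_op :: "complex \<Rightarrow> 'a::complex_hilbert_space \<Rightarrow>\<^sub>L 'a"
  is "\<lambda>c x. c *\<^sub>C x"
  by (rule bounded_linear_scaleC)

lift_definition block_op ::
  "('a::complex_hilbert_space \<Rightarrow>\<^sub>L 'a) \<Rightarrow> ('a \<Rightarrow>\<^sub>L 'a) \<Rightarrow> ('a \<Rightarrow>\<^sub>L 'a) \<Rightarrow> ('a \<Rightarrow>\<^sub>L 'a) \<Rightarrow>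
    ('a \<times> 'a) \<Rightarrow>\<^sub>L ('a \<times> 'a)"
  is "\<lambda>A B C D z. (A (fst z) + B (snd z), C (fst z) + D (snd z))"
  by (intro bounded_linear_Pair bounded_linear_add)
    (auto intro: bounded_linear_compose bounded_linear_fst bounded_linear_snd)

definition adjoint_op :: "('a::complex_hilbert_space \<Rightarrow>\<^sub>L 'a) \<Rightarrow> 'a \<Rightarrow>\<^sub>L 'a"
  where "adjoint_op A = (THE B :: 'a \<Rightarrow>\<^sub>L 'a. \<forall>x y. cinner (A x) y = cinner x (B y))"

definition spectrum_op :: "('a::complex_hilbert_space \<Rightarrow>\<^sub>L 'a) \<Rightarrow> complex set"
  where "spectrum_op T =
    {c. \<not> (\<exists>S. S o\<^sub>L (T - scalar_op c) = id_blinfun \<and> (T - scalar_op c) o\<^sub>L S = id_blinfun)}"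

definition poly_op :: "real poly \<Rightarrow> ('a::complex_hilbert_space \<Rightarrow>\<^sub>L 'a) \<Rightarrow> 'a \<Rightarrow>\<^sub>L 'a"
  where "poly_op P T = (\<Sum>i\<le>degree P. coeff P i *\<^sub>R (((o\<^sub>L) T ^^ i) id_blinfun))"

text \<open>
  Continuous functional calculus of a self-adjoint operator \<open>T\<close>, whose spectrum is real, for a
  real function \<open>f\<close> continuous on the spectrum: \<open>f(T)\<close> is the norm limit of \<open>P\<^sub>n(T)\<close> for
  any polynomials \<open>P\<^sub>n\<close> converging to \<open>f\<close> uniformly on the spectrum of \<open>T\<close>.
\<close>

definition cfc :: "(real \<Rightarrow> real) \<Rightarrow> ('a::complex_hilbert_space \<Rightarrow>\<^sub>L 'a) \<Rightarrow> 'a \<Rightarrow>\<^sub>L 'a"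
  where "cfc f T = (THE S. \<forall>P :: nat \<Rightarrow> real poly.
    uniform_limit {t. complex_of_real t \<in> spectrum_op T} (\<lambda>n t. poly (P n) t) f sequentially
      \<longrightarrow> (\<lambda>n. poly_op (P n) T) \<longlonglongrightarrow> S)"

text \<open>The power \<open>t\<^sup>s\<close> for \<open>t, s \<ge> 0\<close> with \<open>0\<^sup>0 = 1\<close>. The library has \<open>0 powr 0 = 0\<close>, which
  would make \<open>t\<^sup>0\<close> discontinuous on \<open>[0, \<infinity>)\<close>.\<close>

definition rpow :: "real \<Rightarrow> real \<Rightarrow> real"
  where "rpow t s = (if s = 0 then 1 else t powr s)"

definition pow_op :: "('a::complex_hilbert_space \<Rightarrow>\<^sub>L 'a) \<Rightarrow> real \<Rightarrow> 'a \<Rightarrow>\<^sub>L 'a"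
  where "pow_op T s = cfc (\<lambda>t. rpow t s) T"

definition abs_op :: "('a::complex_hilbert_space \<Rightarrow>\<^sub>L 'a) \<Rightarrow> 'a \<Rightarrow>\<^sub>L 'a"
  where "abs_op A = pow_op (adjoint_op A o\<^sub>L A) (1 / 2)"

text \<open>The supremum is taken in \<open>[0, \<infinity>)\<close>: inserting \<open>0\<close> only matters for the zero space, which has
  no unit vectors.\<close>

definition numerical_radius :: "('a::complex_hilbert_space \<Rightarrow>\<^sub>L 'a) \<Rightarrow> real"
  where "numerical_radius A = Sup (insert 0 {cmod (cinner (A x) x) | x. norm x = 1})"

end

theory Submission
  imports Defs "HOL-Computational_Algebra.Fundamental_Theorem_Algebra"
begin

text \<open>
  The blocks decouple: \<open>abs_op (block_op 0 A1 A2 0)\<close> is the diagonal operator with entries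
  \<open>abs_op A2\<close> and \<open>abs_op A1\<close>, and the functional calculus acts entrywise. Write \<open>S\<close>, \<open>T\<close> for the
  moduli of the two block operators, and let \<open>x\<close> be a unit vector. Since \<open>S\<^sup>\<alpha>\<close> is self-adjoint,
  Cauchy--Schwarz bounds the quadratic form at \<open>x\<close> by \<open>\<parallel>Y\<parallel> \<parallel>S\<^sup>\<alpha> x\<parallel> \<parallel>T\<^sup>\<alpha> x\<parallel>\<close>. The square of
  \<open>\<parallel>S\<^sup>\<alpha> x\<parallel>\<close> is \<open>\<langle>S\<^sup>2\<^sup>\<alpha> x, x\<rangle>\<close>, and as \<open>2 * \<alpha> \<le> 2 \<le> p * r\<close>, Jensen's inequality for the functional
  calculus bounds \<open>\<parallel>S\<^sup>\<alpha> x\<parallel>\<^sup>r\<close> by \<open>\<langle>S\<^sup>p\<^sup>r x, x\<rangle> powr (\<alpha> / p)\<close>; likewise for \<open>T\<close> and \<open>q\<close>. Young's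
  inequality combines the two factors. The functional calculus itself rests on the bound of
  \<open>\<parallel>P(T)\<parallel>\<close> by the supremum of \<open>\<bar>P\<bar>\<close> over the real spectrum: if \<open>m = \<parallel>P(T)\<parallel>\<close>, then \<open>P(T)\<^sup>2 - m\<^sup>2\<close> is not
  bounded below, whereas a real polynomial without roots in the spectrum factors into linear and
  irreducible quadratic polynomials, each of which gives an operator that is bounded below.
\<close>

section \<open>Riesz representation and coercive operators\<close>

lemma riesz_representation:
  fixes f :: "'a::{real_inner,banach} \<Rightarrow> real"
  assumes f: "bounded_linear f"
  obtains y where "\<And>x. f x = inner y x"
proof -
  interpret f: bounded_linear f by fact
  define J where "J x = (norm x)\<^sup>2 - 2 * f x" for x
  obtain K where K: "\<And>x. norm (f x) \<le> norm x * K"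
    using f.bounded by blast
  have low: "- K\<^sup>2 \<le> J x" for x
  proof -
    have "0 \<le> (norm x - K)\<^sup>2" by simp
    moreover have "f x \<le> norm x * K" using K[of x] by simp
    ultimately show ?thesis by (simp add: J_def power2_diff)
  qed
  define d where "d = Inf (range J)"
  have bdd: "bdd_below (range J)"
    using low by (intro bdd_belowI) auto
  have d: "d \<le> J x" for x
    unfolding d_def by (rule cInf_lower) (use bdd in auto)
  have "\<exists>x. J x < d + 1 / real (Suc n)" for n
  proof -
    have "Inf (range J) < d + 1 / real (Suc n)" by (simp add: d_def)
    then show ?thesis using cInf_lessD[of "range J"] by auto
  qed
  then obtain X where X: "\<And>n. J (X n) < d + 1 / real (Suc n)" by metis
  have par: "(norm (x - y))\<^sup>2 \<le> 2 * (J x - d) + 2 * (J y - d)" for x y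
  proof -
    have "(norm (x - y))\<^sup>2 = 2 * J x + 2 * J y - 4 * J ((1/2) *\<^sub>R (x + y))"
      unfolding J_def power2_norm_eq_inner
      by (simp add: inner_simps inner_commute f.scaleR f.add algebra_simps power2_eq_square
          del: dot_square_norm)
    with d[of "(1/2) *\<^sub>R (x + y)"] show ?thesis by simp
  qed
  have "Cauchy X"
  proof (rule metric_CauchyI)
    fix e :: real assume e: "e > 0"
    obtain N where N: "4 / e\<^sup>2 < real N" using reals_Archimedean2 by blast
    have "dist (X m) (X n) < e" if "m \<ge> Suc N" "n \<ge> Suc N" for m n
    proof -
      have *: "1 / real (Suc k) < e\<^sup>2 / 4" if "k \<ge> Suc N" for k
      proof -
        have "4 / e\<^sup>2 < real (Suc k)" using N that by linarith
        then show ?thesis using e by (simp add: field_simps)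
      qed
      have "(norm (X m - X n))\<^sup>2 < e\<^sup>2"
        using par[of "X m" "X n"] X[of m] X[of n] *[OF that(1)] *[OF that(2)] by simp
      then show ?thesis using e by (simp add: dist_norm power_less_imp_less_base)
    qed
    then show "\<exists>M. \<forall>m\<ge>M. \<forall>n\<ge>M. dist (X m) (X n) < e" by blast
  qed
  then obtain y where y: "X \<longlonglongrightarrow> y"
    using Cauchy_convergent convergent_def by blast
  have "(\<lambda>n. J (X n)) \<longlonglongrightarrow> J y"
    unfolding J_def by (intro tendsto_intros y f.tendsto)
  moreover have "(\<lambda>n. d + 1 / real (Suc n)) \<longlonglongrightarrow> d + 0"
    by (intro tendsto_intros LIMSEQ_Suc[OF lim_1_over_n])
  ultimately have "J y \<le> d"
    using X by (intro LIMSEQ_le[of "\<lambda>n. J (X n)" _ "\<lambda>n. d + 1 / real (Suc n)"]) (auto intro: less_imp_le)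
  with d have min: "J y \<le> J x" for x by (meson order_trans)
  have "f x = inner y x" for x
  proof (cases "x = 0")
    case False
    define e where "e = inner y x - f x"
    define t where "t = - e / (norm x)\<^sup>2"
    have "J (y + t *\<^sub>R x) = J y + 2 * t * e + t\<^sup>2 * (norm x)\<^sup>2"
      unfolding J_def e_def power2_norm_eq_inner
      by (simp add: inner_simps inner_commute f.scaleR f.add algebra_simps power2_eq_square
          del: dot_square_norm)
    with min[of "y + t *\<^sub>R x"] have "0 \<le> 2 * t * e + t\<^sup>2 * (norm x)\<^sup>2" by simp
    also have "\<dots> = - (e\<^sup>2 / (norm x)\<^sup>2)"
      using False by (simp add: t_def power2_eq_square field_simps)
    finally have "e\<^sup>2 / (norm x)\<^sup>2 \<le> 0" by simp
    then have "e = 0" using False by (simp add: divide_le_0_iff)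
    then show ?thesis by (simp add: e_def)
  qed (simp add: f.zero)
  then show thesis using that by blast
qed

lemma coercive_invertible:
  fixes S :: "'a::{real_inner,banach} \<Rightarrow>\<^sub>L 'a"
  assumes c: "c > 0" and S: "\<And>x. c * (norm x)\<^sup>2 \<le> inner (S x) x"
  obtains R where "R o\<^sub>L S = id_blinfun" "S o\<^sub>L R = id_blinfun"
proof -
  have below: "c * norm x \<le> norm (S x)" for x
  proof (cases "x = 0")
    case False
    have "c * (norm x)\<^sup>2 \<le> norm (S x) * norm x"
      using S norm_cauchy_schwarz order_trans by blast
    with False show ?thesis by (simp add: power2_eq_square)
  qed simp
  define M where "M = norm S + c"
  have M: "M > 0" "norm S \<le> M" "c \<le> M" using c by (auto simp: M_def add_nonneg_pos)
  define e where "e = c / M\<^sup>2"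
  have e: "e > 0" using c M by (simp add: e_def)
  have "\<exists>x. S x = y" for y
  proof -
    define g where "g x = x - e *\<^sub>R (S x - y)" for x
    define k where "k = sqrt (1 - c\<^sup>2 / M\<^sup>2)"
    have q: "0 \<le> 1 - c\<^sup>2 / M\<^sup>2" "1 - c\<^sup>2 / M\<^sup>2 < 1"
      using c M by (auto simp: power_mono)
    have contr: "dist (g x) (g z) \<le> k * dist x z" for x z
    proof -
      define w where "w = x - z"
      have "g x - g z = w - e *\<^sub>R S w"
        by (simp add: g_def w_def blinfun.diff_right algebra_simps)
      then have "(dist (g x) (g z))\<^sup>2 = (norm (w - e *\<^sub>R S w))\<^sup>2" by (simp add: dist_norm)
      also have "\<dots> = (norm w)\<^sup>2 - 2 * e * inner (S w) w + e\<^sup>2 * (norm (S w))\<^sup>2"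
        unfolding power2_norm_eq_inner
        by (simp add: inner_simps inner_commute algebra_simps power2_eq_square del: dot_square_norm)
      also have "\<dots> \<le> (norm w)\<^sup>2 - 2 * e * (c * (norm w)\<^sup>2) + e\<^sup>2 * (M * norm w)\<^sup>2"
      proof -
        have "norm (S w) \<le> M * norm w"
          using norm_blinfun[of S w] mult_right_mono[OF M(2), of "norm w"] by simp
        then have "e\<^sup>2 * (norm (S w))\<^sup>2 \<le> e\<^sup>2 * (M * norm w)\<^sup>2"
          by (intro mult_left_mono power_mono) auto
        moreover have "e * (c * (norm w)\<^sup>2) \<le> e * inner (S w) w"
          using S e by (intro mult_left_mono) auto
        ultimately show ?thesis by simp
      qed
      also have "\<dots> = (1 - c\<^sup>2 / M\<^sup>2) * (norm w)\<^sup>2"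
        using M by (simp add: e_def power2_eq_square field_simps)
      also have "\<dots> = (k * dist x z)\<^sup>2"
        using q by (simp add: k_def power_mult_distrib w_def dist_norm)
      finally show ?thesis
        by (rule power2_le_imp_le) (use q in \<open>simp add: k_def\<close>)
    qed
    have "\<exists>!x. g x = x"
      by (rule banach_fix_type[of k]) (use contr q in \<open>auto simp: k_def\<close>)
    then obtain x where "g x = x" by blast
    then show ?thesis using e by (auto simp: g_def)
  qed
  then obtain R where R: "\<And>y. S (R y) = y" by metis
  have inj: "x = z" if "S x = S z" for x z
    using below[of "x - z"] that c by (simp add: blinfun.diff_right mult_le_0_iff)
  have "bounded_linear R"
  proof (rule bounded_linear_intro[where K = "1 / c"])
    show "R (x + y) = R x + R y" for x y by (rule inj) (simp add: R blinfun.add_right)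
    show "R (t *\<^sub>R x) = t *\<^sub>R R x" for t x by (rule inj) (simp add: R blinfun.scaleR_right)
    show "norm (R x) \<le> norm x * (1 / c)" for x
      using below[of "R x"] c by (simp add: R field_simps)
  qed
  then have RR: "blinfun_apply (Blinfun R) = R" by (rule bounded_linear_Blinfun_apply)
  have "Blinfun R o\<^sub>L S = id_blinfun"
    by (rule blinfun_eqI) (simp add: RR inj R)
  moreover have "S o\<^sub>L Blinfun R = id_blinfun"
    by (rule blinfun_eqI) (simp add: RR R)
  ultimately show thesis using that by blast
qed

section \<open>Polynomials in an operator\<close>

definition bounded_below :: "('a::real_normed_vector \<Rightarrow>\<^sub>L 'a) \<Rightarrow> bool"
  where "bounded_below S \<longleftrightarrow> (\<exists>c>0. \<forall>x. c * norm x \<le> norm (S x))"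

lemma bounded_below_compose:
  assumes "bounded_below S" "bounded_below R"
  shows "bounded_below (S o\<^sub>L R)"
proof -
  obtain c d where c: "c > 0" "\<And>x. c * norm x \<le> norm (S x)"
    and d: "d > 0" "\<And>x. d * norm x \<le> norm (R x)"
    using assms by (auto simp: bounded_below_def)
  have "c * d * norm x \<le> norm (S (R x))" for x
  proof -
    have "c * (d * norm x) \<le> c * norm (R x)" using c d by (intro mult_left_mono) auto
    with c(2)[of "R x"] show ?thesis by (simp add: mult.assoc)
  qed
  then show ?thesis using c d by (auto simp: bounded_below_def intro!: exI[of _ "c * d"])
qed

lemma left_inverse_bounded_below:
  assumes "R o\<^sub>L S = id_blinfun"
  shows "bounded_below S"
proof -
  have "norm x \<le> (norm R + 1) * norm (S x)" for x
  proof -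
    have "x = R (S x)" by (metis assms blinfun_apply_blinfun_compose blinfun_apply_id_blinfun)
    then have "norm x \<le> norm R * norm (S x)" by (metis norm_blinfun)
    then show ?thesis by (simp add: distrib_right add_increasing2)
  qed
  moreover have "norm R + 1 > 0" by (simp add: add_nonneg_pos)
  ultimately show ?thesis unfolding bounded_below_def
    by (intro exI[of _ "1 / (norm R + 1)"]) (simp add: pos_divide_le_eq mult.commute)
qed

lemma poly_op_eq_sum:
  assumes "degree P \<le> n"
  shows "poly_op P T = (\<Sum>i\<le>n. coeff P i *\<^sub>R (((o\<^sub>L) T ^^ i) id_blinfun))"
  unfolding poly_op_def
  by (rule sum.mono_neutral_left) (use assms in \<open>auto simp: coeff_eq_0\<close>)

lemma poly_op_0 [simp]: "poly_op 0 T = 0"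
  by (simp add: poly_op_def)

lemma poly_op_add: "poly_op (P + Q) T = poly_op P T + poly_op Q T"
  by (simp add: poly_op_eq_sum[of _ "max (degree P) (degree Q)"] degree_add_le
      scaleR_left_distrib sum.distrib)

lemma poly_op_smult: "poly_op (smult c P) T = c *\<^sub>R poly_op P T"
  by (simp add: poly_op_eq_sum[of _ "degree P"] degree_smult_le scaleR_sum_right)

lemma poly_op_diff: "poly_op (P - Q) T = poly_op P T - poly_op Q T"
  using poly_op_add[of "P - Q" Q T] by simp

lemma poly_op_pCons: "poly_op (pCons a P) T = a *\<^sub>R id_blinfun + (T o\<^sub>L poly_op P T)"
proof -
  have "poly_op (pCons a P) T
      = (\<Sum>i\<le>Suc (degree P). coeff (pCons a P) i *\<^sub>R (((o\<^sub>L) T ^^ i) id_blinfun))"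
    by (rule poly_op_eq_sum) (rule degree_pCons_le)
  also have "\<dots> = a *\<^sub>R id_blinfun + (\<Sum>i\<le>degree P. coeff P i *\<^sub>R (T o\<^sub>L ((o\<^sub>L) T ^^ i) id_blinfun))"
    by (subst sum.atMost_Suc_shift) simp
  also have "(\<Sum>i\<le>degree P. coeff P i *\<^sub>R (T o\<^sub>L ((o\<^sub>L) T ^^ i) id_blinfun)) = T o\<^sub>L poly_op P T"
    by (simp add: poly_op_def bounded_bilinear.sum_right[OF bounded_bilinear_blinfun_compose]
        bounded_bilinear.scaleR_right[OF bounded_bilinear_blinfun_compose])
  finally show ?thesis .
qed

lemma poly_op_const: "poly_op [:a:] T = a *\<^sub>R id_blinfun"
  by (simp add: poly_op_pCons)

lemma poly_op_mult: "poly_op (P * Q) T = poly_op P T o\<^sub>L poly_op Q T"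
proof (induction P)
  case (pCons a P)
  show ?case
    by (rule blinfun_eqI)
      (simp add: poly_op_add poly_op_smult poly_op_pCons pCons.IH blinfun.bilinear_simps)
qed simp

lemma poly_op_X: "poly_op [:0, 1:] T = T"
  by (rule blinfun_eqI) (simp add: poly_op_pCons)

lemma poly_op_commute: "poly_op P T o\<^sub>L poly_op Q T = poly_op Q T o\<^sub>L poly_op P T"
  by (metis poly_op_mult mult.commute)

definition selfadjoint :: "('a::complex_hilbert_space \<Rightarrow>\<^sub>L 'a) \<Rightarrow> bool"
  where "selfadjoint T \<longleftrightarrow> (\<forall>x y. cinner (T x) y = cinner x (T y))"

lemma selfadjoint_inner: "selfadjoint T \<Longrightarrow> inner (T x) y = inner x (T y)"
  by (simp add: selfadjoint_def inner_eq_Re_cinner)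

lemma cinner_add_right: "cinner x (y + z) = cinner x y + cinner x z"
  by (metis cinner_add_left cinner_commute complex_cnj_add)

lemma cinner_scaleC_right: "cinner x (a *\<^sub>C y) = cnj a * cinner x y"
  by (metis cinner_commute cinner_scaleC_left complex_cnj_mult)

lemma cinner_scaleR_left: "cinner (s *\<^sub>R x) y = complex_of_real s * cinner x y"
  by (simp add: scaleR_scaleC cinner_scaleC_left)

lemma cinner_scaleR_right: "cinner x (s *\<^sub>R y) = complex_of_real s * cinner x y"
  by (simp add: scaleR_scaleC cinner_scaleC_right)

lemma selfadjoint_poly_op:
  assumes T: "selfadjoint T"
  shows "selfadjoint (poly_op P T)"
proof (induction P)
  case (pCons a P)
  have "cinner (T (poly_op P T x)) y = cinner x (T (poly_op P T y))" for x y
  proof -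
    have "cinner (T (poly_op P T x)) y = cinner x (poly_op P T (T y))"
      using T pCons.IH by (simp add: selfadjoint_def)
    also have "poly_op P T (T y) = T (poly_op P T y)"
      using arg_cong[OF poly_op_commute[of P T "[:0, 1:]"], of "\<lambda>S. blinfun_apply S y"]
      by (simp add: poly_op_X)
    finally show ?thesis .
  qed
  then show ?case
    by (simp add: selfadjoint_def poly_op_pCons blinfun.bilinear_simps cinner_add_left
        cinner_add_right cinner_scaleR_left cinner_scaleR_right)
qed (simp add: selfadjoint_def cinner_scaleR_left[of 0, simplified] cinner_scaleR_right[of _ 0, simplified])

definition real_spectrum :: "('a::complex_hilbert_space \<Rightarrow>\<^sub>L 'a) \<Rightarrow> real set"
  where "real_spectrum T = {t. complex_of_real t \<in> spectrum_op T}"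

lemma not_in_real_spectrum:
  "t \<notin> real_spectrum T \<longleftrightarrow>
    (\<exists>S. S o\<^sub>L (T - t *\<^sub>R id_blinfun) = id_blinfun \<and> (T - t *\<^sub>R id_blinfun) o\<^sub>L S = id_blinfun)"
proof -
  have "scalar_op (complex_of_real t) = t *\<^sub>R (id_blinfun :: 'a \<Rightarrow>\<^sub>L 'a)"
    by (rule blinfun_eqI) (simp add: scalar_op.rep_eq scaleR_scaleC blinfun.scaleR_left)
  then show ?thesis by (simp add: real_spectrum_def spectrum_op_def)
qed

lemma map_poly_of_real_add:
  "map_poly complex_of_real (P + Q) = map_poly of_real P + map_poly of_real Q"
  by (rule poly_eqI) (simp add: coeff_map_poly)

lemma map_poly_of_real_smult:
  "map_poly complex_of_real (smult a P) = smult (of_real a) (map_poly of_real P)"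
  by (rule poly_eqI) (simp add: coeff_map_poly)

lemma map_poly_of_real_mult:
  "map_poly complex_of_real (P * Q) = map_poly of_real P * map_poly of_real Q"
  by (induction P) (simp_all add: map_poly_pCons map_poly_of_real_add map_poly_of_real_smult)

lemma poly_map_poly_of_real:
  "poly (map_poly complex_of_real P) (of_real t) = of_real (poly P t)"
  by (induction P) (simp_all add: map_poly_pCons)

lemma real_poly_linear_or_quadratic_factor:
  fixes P :: "real poly"
  assumes "degree P > 0"
  obtains a R where "P = [:-a, 1:] * R"
  | a b R where "b \<noteq> 0" "P = [:a\<^sup>2 + b\<^sup>2, -2 * a, 1:] * R"
proof -
  have "\<exists>z. poly (map_poly complex_of_real P) z = 0"
  proof (rule fundamental_theorem_of_algebra_alt, safe)
    fix a l assume *: "map_poly complex_of_real P = [:a:]"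
    have "degree (map_poly complex_of_real P) = degree P" by (rule degree_map_poly) simp
    with * assms show False by simp
  qed
  then obtain z where z: "poly (map_poly complex_of_real P) z = 0" by blast
  show thesis
  proof (cases "Im z = 0")
    case True
    then have "z = of_real (Re z)" by (simp add: complex_eq_iff)
    with z have "poly P (Re z) = 0" by (metis of_real_eq_0_iff poly_map_poly_of_real)
    then show thesis using that(1) by (metis dvdE poly_eq_0_iff_dvd)
  next
    case False
    define W where "W = [:(Re z)\<^sup>2 + (Im z)\<^sup>2, -2 * Re z, 1:]"
    have W: "poly (map_poly complex_of_real W) z = 0"
      by (simp add: W_def map_poly_pCons complex_eq_iff power2_eq_square algebra_simps)
    have "degree (P mod W) < degree W"
      using degree_mod_less_degree[of W P] degree_mod_less[of W P] by (auto simp: W_def)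
    then have "degree (P mod W) \<le> 1" by (simp add: W_def)
    then obtain u v where uv: "P mod W = [:u, v:]"
      by (metis One_nat_def Suc_le_mono degree_eq_zeroE degree_pCons_eq_if le_zero_eq pCons_0_0 pCons_cases)
    have "map_poly complex_of_real P
        = map_poly of_real W * map_poly of_real (P div W) + map_poly of_real (P mod W)"
      by (metis map_poly_of_real_add map_poly_of_real_mult mult_div_mod_eq)
    with z W have "poly (map_poly complex_of_real [:u, v:]) z = 0"
      by (simp add: uv)
    then have "u + Re z * v = 0" "Im z * v = 0"
      by (simp_all add: map_poly_pCons complex_eq_iff)
    with False have "P mod W = 0" by (simp add: uv)
    then have "P = W * (P div W)" by (metis add.right_neutral mult_div_mod_eq)
    with that(2)[OF False] show thesis unfolding W_def by blast
  qed
qed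

lemma bounded_below_quadratic:
  fixes T :: "'a::complex_hilbert_space \<Rightarrow>\<^sub>L 'a"
  assumes T: "selfadjoint T" and b: "b \<noteq> 0"
  shows "bounded_below (poly_op [:a\<^sup>2 + b\<^sup>2, -2 * a, 1:] T)" (is "bounded_below ?W")
proof -
  have "b\<^sup>2 * norm x \<le> norm (?W x)" for x
  proof (cases "x = 0")
    case False
    have W: "?W x = b\<^sup>2 *\<^sub>R x + a\<^sup>2 *\<^sub>R x - (2 * a) *\<^sub>R T x + T (T x)"
      by (simp add: poly_op_pCons blinfun.bilinear_simps algebra_simps)
    have "inner (?W x) x = b\<^sup>2 * (norm x)\<^sup>2 + (norm (T x - a *\<^sub>R x))\<^sup>2"
      unfolding power2_norm_eq_inner W
      by (simp add: inner_simps inner_commute selfadjoint_inner[OF T] power2_eq_square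
          algebra_simps del: dot_square_norm)
    then have "b\<^sup>2 * (norm x)\<^sup>2 \<le> inner (?W x) x" by simp
    also have "\<dots> \<le> norm (?W x) * norm x" by (rule norm_cauchy_schwarz)
    finally show ?thesis using False by (simp add: power2_eq_square)
  qed simp
  then show ?thesis using b unfolding bounded_below_def by (intro exI[of _ "b\<^sup>2"]) auto
qed

lemma bounded_below_poly_op:
  assumes T: "selfadjoint T"
  shows "P \<noteq> 0 \<Longrightarrow> (\<And>t. t \<in> real_spectrum T \<Longrightarrow> poly P t \<noteq> 0) \<Longrightarrow> bounded_below (poly_op P T)"
proof (induction "degree P" arbitrary: P rule: less_induct)
  case less
  show ?case
  proof (cases "degree P = 0")
    case True
    then obtain c where "P = [:c:]" by (rule degree_eq_zeroE)
    with less.prems show ?thesis unfolding bounded_below_def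
      by (intro exI[of _ "\<bar>c\<bar>"]) (auto simp: poly_op_const blinfun.scaleR_left)
  next
    case False
    then have "degree P > 0" by simp
    then show ?thesis
    proof (cases rule: real_poly_linear_or_quadratic_factor)
      case (1 a R)
      have "bounded_below (poly_op R T)"
      proof (rule less.hyps)
        show "R \<noteq> 0" using less.prems(1) 1 by auto
        then show "degree R < degree P" unfolding 1 by (subst degree_mult_eq) auto
        show "poly R t \<noteq> 0" if "t \<in> real_spectrum T" for t
          using less.prems(2)[OF that] by (auto simp: 1)
      qed
      moreover have "a \<notin> real_spectrum T" using less.prems(2)[of a] by (auto simp: 1)
      then have "bounded_below (T - a *\<^sub>R id_blinfun)"
        using left_inverse_bounded_below unfolding not_in_real_spectrum by blast
      moreover have "poly_op [:-a, 1:] T = T - a *\<^sub>R id_blinfun"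
        by (rule blinfun_eqI) (simp add: poly_op_pCons blinfun.bilinear_simps)
      ultimately show ?thesis unfolding 1 poly_op_mult by (simp add: bounded_below_compose)
    next
      case (2 a b R)
      have "bounded_below (poly_op R T)"
      proof (rule less.hyps)
        show "R \<noteq> 0" using less.prems(1) 2 by auto
        then show "degree R < degree P" unfolding 2 by (subst degree_mult_eq) auto
        show "poly R t \<noteq> 0" if "t \<in> real_spectrum T" for t
          using less.prems(2)[OF that] by (auto simp: 2)
      qed
      then show ?thesis unfolding 2 poly_op_mult
        using bounded_below_compose bounded_below_quadratic[OF T 2(1)] by blast
    qed
  qed
qed

lemma not_bounded_below_square_norm:
  fixes S :: "'a::complex_hilbert_space \<Rightarrow>\<^sub>L 'a"
  assumes S: "selfadjoint S" and m: "m = norm S" "m > 0"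
  shows "\<not> bounded_below ((S o\<^sub>L S) - m\<^sup>2 *\<^sub>R id_blinfun)"
proof
  assume "bounded_below ((S o\<^sub>L S) - m\<^sup>2 *\<^sub>R id_blinfun)"
  then obtain c where c: "c > 0" "\<And>x. c * norm x \<le> norm (S (S x) - m\<^sup>2 *\<^sub>R x)"
    by (auto simp: bounded_below_def blinfun.bilinear_simps)
  have le: "(norm (S x))\<^sup>2 \<le> (m\<^sup>2 - c\<^sup>2 / m\<^sup>2) * (norm x)\<^sup>2" for x
  proof -
    have "(c * norm x)\<^sup>2 \<le> (norm (S (S x) - m\<^sup>2 *\<^sub>R x))\<^sup>2"
      using c by (intro power_mono) auto
    also have "\<dots> = (norm (S (S x)))\<^sup>2 - 2 * m\<^sup>2 * (norm (S x))\<^sup>2 + m\<^sup>2 * m\<^sup>2 * (norm x)\<^sup>2"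
      unfolding power2_norm_eq_inner
      by (simp add: inner_simps inner_commute selfadjoint_inner[OF S, of x] algebra_simps
           power2_eq_square del: dot_square_norm)
    also have "(norm (S (S x)))\<^sup>2 \<le> (m * norm (S x))\<^sup>2"
      unfolding m by (intro power_mono norm_blinfun) auto
    finally have "c\<^sup>2 * (norm x)\<^sup>2 \<le> m\<^sup>2 * (m\<^sup>2 * (norm x)\<^sup>2 - (norm (S x))\<^sup>2)"
      by (simp add: power_mult_distrib algebra_simps)
    then show ?thesis using m(2) by (simp add: field_simps)
  qed
  define k where "k = m\<^sup>2 - c\<^sup>2 / m\<^sup>2"
  have "norm (S x) \<le> sqrt (max 0 k) * norm x" for x
  proof -
    have "(norm (S x))\<^sup>2 \<le> max 0 k * (norm x)\<^sup>2"
      using le[of x] mult_right_mono[of k "max 0 k" "(norm x)\<^sup>2"] by (simp add: k_def)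
    from real_sqrt_le_mono[OF this] show ?thesis by (simp add: real_sqrt_mult)
  qed
  then have "m \<le> sqrt (max 0 k)" unfolding m by (intro norm_blinfun_bound) auto
  then have "m\<^sup>2 \<le> max 0 k" using m(2) by (metis less_imp_le real_le_rsqrt real_sqrt_le_iff real_sqrt_unique)
  moreover have "c\<^sup>2 / m\<^sup>2 > 0" using m(2) c(1) by simp
  ultimately show False using m(2) by (auto simp: k_def le_max_iff_disj)
qed

lemma norm_poly_op_le:
  assumes T: "selfadjoint T" and e: "e \<ge> 0"
    and le: "\<And>t. t \<in> real_spectrum T \<Longrightarrow> \<bar>poly P t\<bar> \<le> e"
  shows "norm (poly_op P T) \<le> e"
proof (rule ccontr)
  assume "\<not> norm (poly_op P T) \<le> e"
  then have gt: "norm (poly_op P T) > e" by simp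
  have root: "\<exists>t \<in> real_spectrum T. \<bar>poly R t\<bar> = norm (poly_op R T)"
    if "R * R \<noteq> [:(norm (poly_op R T))\<^sup>2:]" "norm (poly_op R T) > 0" for R
  proof (rule ccontr)
    assume no: "\<not> ?thesis"
    define m where "m = norm (poly_op R T)"
    have "bounded_below (poly_op (R * R - [:m\<^sup>2:]) T)"
    proof (rule bounded_below_poly_op[OF T])
      show "R * R - [:m\<^sup>2:] \<noteq> 0" using that by (simp add: m_def)
      fix t assume "t \<in> real_spectrum T"
      with no have "\<bar>poly R t\<bar> \<noteq> m" by (auto simp: m_def)
      moreover have "m \<ge> 0" by (simp add: m_def)
      ultimately have "(poly R t)\<^sup>2 \<noteq> m\<^sup>2" by (metis abs_of_nonneg power2_eq_iff_nonneg abs_ge_zero power2_abs)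
      then show "poly (R * R - [:m\<^sup>2:]) t \<noteq> 0" by (simp add: power2_eq_square)
    qed
    then show False
      using not_bounded_below_square_norm[OF selfadjoint_poly_op[OF T] m_def] that(2)
      by (simp add: poly_op_diff poly_op_mult poly_op_const m_def)
  qed
  show False
  proof (cases "P * P = [:(norm (poly_op P T))\<^sup>2:]")
    case True
    have "real_spectrum T = {}"
    proof (rule ccontr)
      assume "real_spectrum T \<noteq> {}"
      then obtain t where t: "t \<in> real_spectrum T" by blast
      have "(poly P t)\<^sup>2 = (norm (poly_op P T))\<^sup>2"
        using arg_cong[OF True, of "\<lambda>R. poly R t"] by (simp add: power2_eq_square)
      then have "\<bar>poly P t\<bar> = norm (poly_op P T)" by (metis abs_norm_cancel power2_eq_iff abs_minus)
      with le[OF t] gt show False by simp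
    qed
    with root[of "[:0, 1:]"] have "T = 0" by (auto simp: poly_op_X)
    then have "bounded_below (poly_op [:0, 1:] (0 :: 'a \<Rightarrow>\<^sub>L 'a))"
      using bounded_below_poly_op[OF T, of "[:0, 1:]"] \<open>real_spectrum T = {}\<close> by auto
    then have "norm x = 0" for x :: 'a
      by (auto simp: poly_op_X bounded_below_def mult_le_0_iff)
    then have "poly_op P T = 0" by (intro blinfun_eqI) (metis norm_eq_zero)
    with gt e show False by simp
  next
    case False
    with root[of P] gt e le show False by fastforce
  qed
qed

section \<open>Functional calculus of positive operators\<close>

definition positive_op :: "('a::complex_hilbert_space \<Rightarrow>\<^sub>L 'a) \<Rightarrow> bool"
  where "positive_op T \<longleftrightarrow> selfadjoint T \<and> (\<forall>x. 0 \<le> inner (T x) x)"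

lemma real_spectrum_positive_op:
  assumes T: "positive_op T"
  shows "real_spectrum T \<subseteq> {0..norm T}"
proof
  fix t assume t: "t \<in> real_spectrum T"
  have "t \<ge> 0"
  proof (rule ccontr)
    assume "\<not> t \<ge> 0"
    then have "- t > 0" by simp
    moreover have "- t * (norm x)\<^sup>2 \<le> inner ((T - t *\<^sub>R id_blinfun) x) x" for x
      using T by (simp add: positive_op_def blinfun.bilinear_simps inner_simps power2_norm_eq_inner)
    ultimately obtain R where "R o\<^sub>L (T - t *\<^sub>R id_blinfun) = id_blinfun"
        "(T - t *\<^sub>R id_blinfun) o\<^sub>L R = id_blinfun"
      by (rule coercive_invertible)
    with t not_in_real_spectrum show False by blast
  qed
  moreover have "t \<le> norm T"
  proof (rule ccontr)
    assume "\<not> t \<le> norm T"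
    then have "t - norm T > 0" by simp
    moreover have "(t - norm T) * (norm x)\<^sup>2 \<le> inner ((t *\<^sub>R id_blinfun - T) x) x" for x
    proof -
      have "inner (T x) x \<le> norm (T x) * norm x" by (rule norm_cauchy_schwarz)
      also have "\<dots> \<le> norm T * (norm x)\<^sup>2"
        using mult_right_mono[OF norm_blinfun[of T x], of "norm x"] by (simp add: power2_eq_square)
      finally show ?thesis
        by (simp add: blinfun.bilinear_simps inner_simps power2_norm_eq_inner left_diff_distrib)
    qed
    ultimately obtain R where R: "R o\<^sub>L (t *\<^sub>R id_blinfun - T) = id_blinfun"
        "(t *\<^sub>R id_blinfun - T) o\<^sub>L R = id_blinfun"
      by (rule coercive_invertible)
    have "(- R) o\<^sub>L (T - t *\<^sub>R id_blinfun) = id_blinfun"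
      using R(1) by (metis minus_diff_eq bounded_bilinear.minus_left bounded_bilinear.minus_right
          bounded_bilinear_blinfun_compose minus_minus)
    moreover have "(T - t *\<^sub>R id_blinfun) o\<^sub>L (- R) = id_blinfun"
      using R(2) by (metis minus_diff_eq bounded_bilinear.minus_left bounded_bilinear.minus_right
          bounded_bilinear_blinfun_compose minus_minus)
    ultimately show False using t not_in_real_spectrum by blast
  qed
  ultimately show "t \<in> {0..norm T}" by simp
qed

lemma Weierstrass_poly_sequence:
  fixes f :: "real \<Rightarrow> real"
  assumes "compact S" "continuous_on S f"
  obtains P where "uniform_limit S (\<lambda>n t. poly (P n) t) f sequentially"
proof -
  have "\<exists>P. \<forall>t\<in>S. \<bar>f t - poly P t\<bar> < 1 / real (Suc n)" for n
  proof -
    obtain g where g: "real_polynomial_function g" "\<And>t. t \<in> S \<Longrightarrow> \<bar>f t - g t\<bar> < 1 / real (Suc n)"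
      using Stone_Weierstrass_real_polynomial_function[OF assms, of "1 / real (Suc n)"] by auto
    obtain a m where "g = (\<lambda>t. \<Sum>i\<le>m. a i * t ^ i)"
      using g(1) unfolding real_polynomial_function_iff_sum by blast
    then have "g t = poly (\<Sum>i\<le>m. monom (a i) i) t" for t
      by (simp add: poly_sum poly_monom)
    with g(2) show ?thesis by auto
  qed
  then obtain P where P: "\<And>n t. t \<in> S \<Longrightarrow> \<bar>f t - poly (P n) t\<bar> < 1 / real (Suc n)" by metis
  have "uniform_limit S (\<lambda>n t. poly (P n) t) f sequentially"
  proof (rule uniform_limitI)
    fix e :: real assume "e > 0"
    then have "\<forall>\<^sub>F n in sequentially. 1 / real (Suc n) < e"
      by (intro order_tendstoD(2)[OF LIMSEQ_Suc[OF lim_1_over_n]])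
    then show "\<forall>\<^sub>F n in sequentially. \<forall>t\<in>S. dist (poly (P n) t) (f t) < e"
    proof (rule eventually_mono, intro ballI)
      fix n t assume "1 / real (Suc n) < e" "t \<in> S"
      with P[of t n] show "dist (poly (P n) t) (f t) < e" by (simp add: dist_real_def)
    qed
  qed
  then show thesis using that by blast
qed

lemma poly_op_uniformly_close:
  assumes T: "selfadjoint T" and e: "e > 0"
    and P: "uniform_limit (real_spectrum T) (\<lambda>n t. poly (P n) t) f sequentially"
    and Q: "uniform_limit (real_spectrum T) (\<lambda>n t. poly (Q n) t) f sequentially"
  obtains N where "\<And>m n. m \<ge> N \<Longrightarrow> n \<ge> N \<Longrightarrow> norm (poly_op (P m) T - poly_op (Q n) T) \<le> e"
proof -
  obtain N1 where N1: "\<And>n t. n \<ge> N1 \<Longrightarrow> t \<in> real_spectrum T \<Longrightarrow> \<bar>poly (P n) t - f t\<bar> < e / 2"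
    using uniform_limitD[OF P, of "e / 2"] e by (auto simp: eventually_sequentially dist_real_def)
  obtain N2 where N2: "\<And>n t. n \<ge> N2 \<Longrightarrow> t \<in> real_spectrum T \<Longrightarrow> \<bar>poly (Q n) t - f t\<bar> < e / 2"
    using uniform_limitD[OF Q, of "e / 2"] e by (auto simp: eventually_sequentially dist_real_def)
  show thesis
  proof (rule that[of "max N1 N2"])
    fix m n assume mn: "max N1 N2 \<le> m" "max N1 N2 \<le> n"
    show "norm (poly_op (P m) T - poly_op (Q n) T) \<le> e"
      unfolding poly_op_diff[symmetric]
    proof (rule norm_poly_op_le[OF T])
      fix t assume "t \<in> real_spectrum T"
      then show "\<bar>poly (P m - Q n) t\<bar> \<le> e"
        using N1[of m t] N2[of n t] mn by (simp add: abs_if split: if_splits)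
    qed (use e in simp)
  qed
qed

lemma cfc_tendsto_spectrum:
  fixes T :: "'a::complex_hilbert_space \<Rightarrow>\<^sub>L 'a"
  assumes T: "selfadjoint T" "real_spectrum T \<subseteq> {a..b}" and f: "continuous_on {a..b} f"
    and P: "uniform_limit (real_spectrum T) (\<lambda>n t. poly (P n) t) f sequentially"
  shows "(\<lambda>n. poly_op (P n) T) \<longlonglongrightarrow> cfc f T"
proof -
  obtain P0 where "uniform_limit {a..b} (\<lambda>n t. poly (P0 n) t) f sequentially"
    using Weierstrass_poly_sequence[OF compact_Icc f] by blast
  then have P0: "uniform_limit (real_spectrum T) (\<lambda>n t. poly (P0 n) t) f sequentially"
    using T(2) uniform_limit_on_subset by blast
  have "Cauchy (\<lambda>n. poly_op (P0 n) T)"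
  proof (rule metric_CauchyI)
    fix e :: real assume "e > 0"
    then obtain N where N:
      "\<And>m n. m \<ge> N \<Longrightarrow> n \<ge> N \<Longrightarrow> norm (poly_op (P0 m) T - poly_op (P0 n) T) \<le> e / 2"
      using poly_op_uniformly_close[OF T(1) _ P0 P0, of "e / 2"] by auto
    with \<open>e > 0\<close> have "\<And>m n. m \<ge> N \<Longrightarrow> n \<ge> N \<Longrightarrow> dist (poly_op (P0 m) T) (poly_op (P0 n) T) < e"
      unfolding dist_norm by (smt (verit) field_sum_of_halves)
    then show "\<exists>M. \<forall>m\<ge>M. \<forall>n\<ge>M. dist (poly_op (P0 m) T) (poly_op (P0 n) T) < e" by blast
  qed
  then obtain S where S: "(\<lambda>n. poly_op (P0 n) T) \<longlonglongrightarrow> S"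
    using Cauchy_convergent convergent_def by blast
  have lim: "(\<lambda>n. poly_op (Q n) T) \<longlonglongrightarrow> S"
    if Q: "uniform_limit (real_spectrum T) (\<lambda>n t. poly (Q n) t) f sequentially" for Q
  proof -
    have "(\<lambda>n. poly_op (Q n) T - poly_op (P0 n) T) \<longlonglongrightarrow> 0"
    proof (rule LIMSEQ_I)
      fix e :: real assume "e > 0"
      then obtain N where N:
        "\<And>m n. m \<ge> N \<Longrightarrow> n \<ge> N \<Longrightarrow> norm (poly_op (Q m) T - poly_op (P0 n) T) \<le> e / 2"
        using poly_op_uniformly_close[OF T(1) _ Q P0, of "e / 2"] by auto
      with \<open>e > 0\<close> show "\<exists>N. \<forall>n\<ge>N. norm (poly_op (Q n) T - poly_op (P0 n) T - 0) < e"
        by (intro exI[of _ N] allI impI) (smt (verit) diff_zero field_sum_of_halves)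
    qed
    from tendsto_add[OF this S] show ?thesis by simp
  qed
  have "cfc f T = S"
    unfolding cfc_def real_spectrum_def[symmetric]
  proof (rule the_equality)
    fix S' assume "\<forall>P. uniform_limit (real_spectrum T) (\<lambda>n t. poly (P n) t) f sequentially
      \<longrightarrow> (\<lambda>n. poly_op (P n) T) \<longlonglongrightarrow> S'"
    with P0 have "(\<lambda>n. poly_op (P0 n) T) \<longlonglongrightarrow> S'" by blast
    then show "S' = S" using S LIMSEQ_unique by blast
  qed (use lim in blast)
  with lim P show ?thesis by simp
qed

lemma cfc_tendsto:
  assumes T: "positive_op T" "norm T \<le> M" and f: "continuous_on {0..} f"
    and P: "uniform_limit {0..M} (\<lambda>n t. poly (P n) t) f sequentially"
  shows "(\<lambda>n. poly_op (P n) T) \<longlonglongrightarrow> cfc f T"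
proof (rule cfc_tendsto_spectrum)
  show sub: "real_spectrum T \<subseteq> {0..M}"
    using real_spectrum_positive_op[OF T(1)] T(2) by auto
  show "selfadjoint T" using T(1) by (simp add: positive_op_def)
  show "continuous_on {0..M} f" using f by (rule continuous_on_subset) auto
  show "uniform_limit (real_spectrum T) (\<lambda>n t. poly (P n) t) f sequentially"
    using P sub uniform_limit_on_subset by blast
qed

lemma half_line_poly_approximation:
  fixes f :: "real \<Rightarrow> real"
  assumes "continuous_on {0..} f"
  obtains P where "uniform_limit {0..M} (\<lambda>n t. poly (P n) t) f sequentially"
proof -
  have "continuous_on {0..M} f" using assms by (rule continuous_on_subset) auto
  then show thesis using Weierstrass_poly_sequence[OF compact_Icc] that by blast
qed

lemma cfc_cong:
  assumes "positive_op T" "\<And>t. t \<ge> 0 \<Longrightarrow> f t = g t"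
  shows "cfc f T = cfc g T"
proof -
  have "uniform_limit (real_spectrum T) P f sequentially
      \<longleftrightarrow> uniform_limit (real_spectrum T) P g sequentially" for P :: "nat \<Rightarrow> real \<Rightarrow> real"
    using assms(2) real_spectrum_positive_op[OF assms(1)]
    by (intro uniform_limit_cong') (auto simp: subset_iff)
  then show ?thesis unfolding cfc_def real_spectrum_def[symmetric] by simp
qed

lemma cfc_const:
  assumes "positive_op T"
  shows "cfc (\<lambda>_. c) T = c *\<^sub>R id_blinfun"
proof -
  have "(\<lambda>n::nat. poly_op [:c:] T) \<longlonglongrightarrow> cfc (\<lambda>_. c) T"
    by (rule cfc_tendsto[OF assms order_refl]) (auto simp: uniform_limit_iff)
  then show ?thesis by (simp add: poly_op_const LIMSEQ_const_iff)
qed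

lemma cfc_add:
  assumes T: "positive_op T" and f: "continuous_on {0..} f" and g: "continuous_on {0..} g"
  shows "cfc (\<lambda>t. f t + g t) T = cfc f T + cfc g T"
proof -
  obtain P where P: "uniform_limit {0..norm T} (\<lambda>n t. poly (P n) t) f sequentially"
    using half_line_poly_approximation[OF f] by blast
  obtain Q where Q: "uniform_limit {0..norm T} (\<lambda>n t. poly (Q n) t) g sequentially"
    using half_line_poly_approximation[OF g] by blast
  have "(\<lambda>n. poly_op (P n + Q n) T) \<longlonglongrightarrow> cfc (\<lambda>t. f t + g t) T"
    by (rule cfc_tendsto[OF T order_refl])
      (auto intro!: continuous_intros f g uniform_limit_add P Q simp del: atLeastAtMost_iff)
  moreover have "(\<lambda>n. poly_op (P n + Q n) T) \<longlonglongrightarrow> cfc f T + cfc g T"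
    unfolding poly_op_add
    by (intro tendsto_add cfc_tendsto[OF T order_refl] f g P Q)
  ultimately show ?thesis by (rule LIMSEQ_unique)
qed

lemma cfc_mult:
  assumes T: "positive_op T" and f: "continuous_on {0..} f" and g: "continuous_on {0..} g"
  shows "cfc (\<lambda>t. f t * g t) T = cfc f T o\<^sub>L cfc g T"
proof -
  obtain P where P: "uniform_limit {0..norm T} (\<lambda>n t. poly (P n) t) f sequentially"
    using half_line_poly_approximation[OF f] by blast
  obtain Q where Q: "uniform_limit {0..norm T} (\<lambda>n t. poly (Q n) t) g sequentially"
    using half_line_poly_approximation[OF g] by blast
  have bdd: "bounded (h ` {0..norm T})" if "continuous_on {0..} h" for h :: "real \<Rightarrow> real"
    by (intro compact_imp_bounded compact_continuous_image continuous_on_subset[OF that]) auto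
  have "uniform_limit {0..norm T} (\<lambda>n t. poly (P n * Q n) t) (\<lambda>t. f t * g t) sequentially"
    unfolding poly_mult by (rule uniform_lim_mult[OF P Q bdd[OF f] bdd[OF g]])
  then have "(\<lambda>n. poly_op (P n * Q n) T) \<longlonglongrightarrow> cfc (\<lambda>t. f t * g t) T"
    by (intro cfc_tendsto[OF T order_refl] continuous_intros f g)
  moreover have "(\<lambda>n. poly_op (P n * Q n) T) \<longlonglongrightarrow> (cfc f T o\<^sub>L cfc g T)"
    unfolding poly_op_mult
    by (intro bounded_bilinear.tendsto[OF bounded_bilinear_blinfun_compose]
        cfc_tendsto[OF T order_refl] f g P Q)
  ultimately show ?thesis by (rule LIMSEQ_unique)
qed

lemma cfc_scaleR:
  assumes T: "positive_op T" and f: "continuous_on {0..} f"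
  shows "cfc (\<lambda>t. c * f t) T = c *\<^sub>R cfc f T"
proof -
  have "cfc (\<lambda>t. c * f t) T = cfc (\<lambda>_. c) T o\<^sub>L cfc f T"
    by (intro cfc_mult T f continuous_intros)
  then show ?thesis
    by (simp add: cfc_const[OF T] blinfun_eqI blinfun.scaleR_left)
qed

lemma cmod_cinner_le: "cmod (cinner x y) \<le> norm x * norm y"
proof (cases "cinner x y = 0")
  case False
  define u where "u = cnj (cinner x y) / of_real (cmod (cinner x y))"
  have u: "cmod u = 1" using False by (simp add: u_def norm_divide)
  have "cnj (cinner x y) * cinner x y = of_real (cmod (cinner x y)) * of_real (cmod (cinner x y))"
    by (metis complex_norm_square mult.commute of_real_mult power2_eq_square)
  then have "u * cinner x y = of_real (cmod (cinner x y))"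
    using False by (simp add: u_def)
  then have "cmod (cinner x y) = inner (u *\<^sub>C x) y"
    by (simp add: inner_eq_Re_cinner cinner_scaleC_left)
  also have "\<dots> \<le> norm (u *\<^sub>C x) * norm y" by (rule norm_cauchy_schwarz)
  finally show ?thesis by (simp add: norm_scaleC u)
qed simp

lemma bounded_bilinear_cinner: "bounded_bilinear cinner"
  by unfold_locales
    (auto simp: cinner_add_left cinner_add_right cinner_scaleR_left cinner_scaleR_right
      scaleR_conv_of_real intro!: exI[of _ 1] cmod_cinner_le)

lemma selfadjoint_limit:
  assumes S: "S \<longlonglongrightarrow> T" and sa: "\<And>n. selfadjoint (S n)"
  shows "selfadjoint T"
  unfolding selfadjoint_def
proof (intro allI)
  fix x y
  have "(\<lambda>n. cinner (S n x) y) \<longlonglongrightarrow> cinner (T x) y"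
    by (intro bounded_bilinear.tendsto[OF bounded_bilinear_cinner] blinfun.tendsto S tendsto_const)
  moreover have "(\<lambda>n. cinner (S n x) y) \<longlonglongrightarrow> cinner x (T y)"
    unfolding sa[unfolded selfadjoint_def, rule_format]
    by (intro bounded_bilinear.tendsto[OF bounded_bilinear_cinner] blinfun.tendsto S tendsto_const)
  ultimately show "cinner (T x) y = cinner x (T y)" by (rule LIMSEQ_unique)
qed

lemma selfadjoint_cfc:
  assumes T: "positive_op T" and f: "continuous_on {0..} f"
  shows "selfadjoint (cfc f T)"
proof -
  obtain P where "uniform_limit {0..norm T} (\<lambda>n t. poly (P n) t) f sequentially"
    using half_line_poly_approximation[OF f] by blast
  then have "(\<lambda>n. poly_op (P n) T) \<longlonglongrightarrow> cfc f T"
    by (rule cfc_tendsto[OF T order_refl f])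
  then show ?thesis
    by (rule selfadjoint_limit) (use T in \<open>simp add: selfadjoint_poly_op positive_op_def\<close>)
qed

lemma norm_cfc_apply:
  assumes T: "positive_op T" and f: "continuous_on {0..} f"
  shows "(norm (cfc f T x))\<^sup>2 = inner (cfc (\<lambda>t. f t * f t) T x) x"
  unfolding cfc_mult[OF T f f] power2_norm_eq_inner
  using selfadjoint_inner[OF selfadjoint_cfc[OF T f], of "cfc f T x" x]
  by (simp add: inner_commute)

lemma positive_op_cfc:
  assumes T: "positive_op T" and f: "continuous_on {0..} f" and nn: "\<And>t. t \<ge> 0 \<Longrightarrow> f t \<ge> 0"
  shows "positive_op (cfc f T)"
proof -
  have s: "continuous_on {0..} (\<lambda>t. sqrt (f t))" by (intro continuous_intros f)
  have "cfc f T = cfc (\<lambda>t. sqrt (f t) * sqrt (f t)) T"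
    by (rule cfc_cong[OF T]) (simp add: nn)
  then have "inner (cfc f T x) x = (norm (cfc (\<lambda>t. sqrt (f t)) T x))\<^sup>2" for x
    unfolding norm_cfc_apply[OF T s] by simp
  then have "0 \<le> inner (cfc f T x) x" for x by simp
  with selfadjoint_cfc[OF T f] show ?thesis by (simp add: positive_op_def)
qed

lemma continuous_on_rpow:
  assumes "s \<ge> 0"
  shows "continuous_on {0..} (\<lambda>t. rpow t s)"
proof (cases "s = 0")
  case False
  with assms have "continuous_on {0..} (\<lambda>t::real. t powr s)"
    by (intro continuous_on_powr' continuous_on_id continuous_on_const) auto
  with False show ?thesis by (simp add: rpow_def)
qed (simp add: rpow_def)

lemma rpow_nonneg: "0 \<le> rpow t s"
  by (simp add: rpow_def)

lemma positive_op_pow_op: "positive_op T \<Longrightarrow> s \<ge> 0 \<Longrightarrow> positive_op (pow_op T s)"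
  unfolding pow_op_def by (rule positive_op_cfc) (auto intro: continuous_on_rpow rpow_nonneg)

lemma inner_pow_op_nonneg: "positive_op T \<Longrightarrow> s \<ge> 0 \<Longrightarrow> 0 \<le> inner (pow_op T s x) x"
  by (drule (1) positive_op_pow_op) (simp add: positive_op_def)

lemma pow_op_0: "positive_op T \<Longrightarrow> pow_op T 0 = id_blinfun"
  by (simp add: pow_op_def rpow_def cfc_const)

lemma norm_pow_op_apply:
  assumes T: "positive_op T" and s: "s \<ge> 0"
  shows "(norm (pow_op T s x))\<^sup>2 = inner (pow_op T (2 * s) x) x"
proof -
  have "rpow t s * rpow t s = rpow t (2 * s)" for t
    by (simp add: rpow_def flip: powr_add)
  then show ?thesis unfolding pow_op_def norm_cfc_apply[OF T continuous_on_rpow[OF s]] by simp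
qed

lemma powr_tangent_le:
  fixes w c s :: real
  assumes "w \<ge> 0" "c > 0" "s \<ge> 1"
  shows "s * c powr (s - 1) * w \<le> w powr s + (s - 1) * c powr s"
proof (cases "s = 1")
  case False
  define q where "q = s / (s - 1)"
  have q: "s > 1" "q > 1" "1 / s + 1 / q = 1" using assms False by (auto simp: q_def field_simps)
  have "w * c powr (s - 1) \<le> w powr s / s + (c powr (s - 1)) powr q / q"
    by (rule Youngs_inequality) (use q assms in auto)
  also have "(c powr (s - 1)) powr q = c powr s"
    using q by (simp add: powr_powr q_def)
  also have "w powr s / s + c powr s / q = (w powr s + (s - 1) * c powr s) / s"
    using q by (simp add: q_def field_simps)
  finally show ?thesis using q by (simp add: pos_le_divide_eq mult_ac)
qed (use assms in auto)

text \<open>The Hoelder--McCarthy inequality: the tangent of \<open>w \<mapsto> w powr (v / u)\<close> at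
  \<open>w = inner (pow_op T u x) x\<close> lies below the graph, and the functional calculus is monotone.\<close>

lemma inner_pow_op_powr_le:
  assumes T: "positive_op T" and uv: "0 < u" "u \<le> v" and x: "norm x = 1"
  shows "(inner (pow_op T u x) x) powr (v / u) \<le> inner (pow_op T v x) x"
proof -
  define c where "c = inner (pow_op T u x) x"
  define s where "s = v / u"
  have s: "s \<ge> 1" using uv by (simp add: s_def)
  note nn = inner_pow_op_nonneg[OF T]
  show ?thesis
  proof (cases "c = 0")
    case True
    then show ?thesis using nn[of v x] uv by (simp add: c_def)
  next
    case False
    with nn[of u x] uv have c: "c > 0" by (simp add: c_def)
    note cont = continuous_on_rpow[of u] continuous_on_rpow[of v]
    define k where "k = - (s * c powr (s - 1))"
    define h where "h t = rpow t v + ((s - 1) * c powr s + k * rpow t u)" for t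
    have "0 \<le> h t" for t
    proof -
      have "rpow t v = rpow t u powr s" using uv by (simp add: rpow_def s_def powr_powr)
      then show ?thesis
        using powr_tangent_le[OF rpow_nonneg[of t u] c s] by (simp add: h_def k_def)
    qed
    moreover have "continuous_on {0..} h"
      unfolding h_def using uv by (intro continuous_intros cont) auto
    ultimately have "positive_op (cfc h T)" using positive_op_cfc[OF T] by blast
    moreover have "cfc h T = pow_op T v + (((s - 1) * c powr s) *\<^sub>R id_blinfun + k *\<^sub>R pow_op T u)"
      unfolding h_def pow_op_def using uv cont T
      by (simp add: cfc_add cfc_const cfc_scaleR continuous_on_add continuous_on_mult_left)
    ultimately have "0 \<le> inner (pow_op T v x) x + (s - 1) * c powr s + k * c"
      using x by (auto simp: positive_op_def blinfun.bilinear_simps inner_simps c_def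
          power2_norm_eq_inner[symmetric] dest!: spec[of _ x])
    moreover have "k * c = - (s * c powr s)"
      using c by (simp add: k_def powr_diff)
    ultimately show ?thesis by (simp add: c_def[symmetric] s_def[symmetric] algebra_simps)
  qed
qed

lemma norm_pow_op_powr_le:
  assumes T: "positive_op T" and u: "0 < u" "2 * u \<le> v" and x: "norm x = 1"
  shows "norm (pow_op T u x) powr (v / u) \<le> inner (pow_op T v x) x"
proof -
  have "norm (pow_op T u x) powr (v / u) = ((norm (pow_op T u x))\<^sup>2) powr (v / (2 * u))"
    using u by (simp add: powr_powr flip: powr_numeral)
  then show ?thesis
    using inner_pow_op_powr_le[OF T, of "2 * u" v x] u x norm_pow_op_apply[OF T, of u x] by simp
qed

section \<open>Block operators\<close>

lemma block_op_apply:
  "block_op A B C D z = (A (fst z) + B (snd z), C (fst z) + D (snd z))"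
  by (simp add: block_op.rep_eq)

lemma positive_op_block_diag:
  assumes "positive_op S" "positive_op T"
  shows "positive_op (block_op S 0 0 T)"
  using assms by (simp add: positive_op_def selfadjoint_def block_op_apply cinner_prod_def inner_prod_def)

lemma poly_op_block_diag:
  "poly_op P (block_op S 0 0 T) = block_op (poly_op P S) 0 0 (poly_op P T)"
proof (induction P)
  case (pCons a P)
  then show ?case
    by (intro blinfun_eqI) (simp add: poly_op_pCons block_op_apply blinfun.bilinear_simps prod_eq_iff)
qed (auto intro!: blinfun_eqI simp: block_op_apply prod_eq_iff)

lemma cfc_block_diag:
  assumes S: "positive_op S" and T: "positive_op T" and f: "continuous_on {0..} f"
  shows "cfc f (block_op S 0 0 T) = block_op (cfc f S) 0 0 (cfc f T)"
proof (rule blinfun_eqI)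
  fix z
  define M where "M = max (norm (block_op S 0 0 T)) (max (norm S) (norm T))"
  obtain P where P: "uniform_limit {0..M} (\<lambda>n t. poly (P n) t) f sequentially"
    using half_line_poly_approximation[OF f] by blast
  have "(\<lambda>n. poly_op (P n) (block_op S 0 0 T)) \<longlonglongrightarrow> cfc f (block_op S 0 0 T)"
    by (rule cfc_tendsto[OF positive_op_block_diag[OF S T] _ f P]) (simp add: M_def)
  then have "(\<lambda>n. poly_op (P n) (block_op S 0 0 T) z) \<longlonglongrightarrow> cfc f (block_op S 0 0 T) z"
    by (intro blinfun.tendsto tendsto_const)
  moreover have "(\<lambda>n. poly_op (P n) (block_op S 0 0 T) z)
      \<longlonglongrightarrow> (cfc f S (fst z), cfc f T (snd z))"
    unfolding poly_op_block_diag block_op_apply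
    by (simp, intro tendsto_Pair blinfun.tendsto tendsto_const cfc_tendsto[OF S _ f P]
        cfc_tendsto[OF T _ f P]) (auto simp: M_def)
  ultimately show "cfc f (block_op S 0 0 T) z = block_op (cfc f S) 0 0 (cfc f T) z"
    by (simp add: block_op_apply LIMSEQ_unique)
qed

lemma pow_op_block_diag:
  assumes "positive_op S" "positive_op T" "s \<ge> 0"
  shows "pow_op (block_op S 0 0 T) s = block_op (pow_op S s) 0 0 (pow_op T s)"
  unfolding pow_op_def by (intro cfc_block_diag assms continuous_on_rpow)

lemma adjoint_op_eqI:
  fixes A B :: "'a::complex_hilbert_space \<Rightarrow>\<^sub>L 'a"
  assumes "\<And>x y. cinner (A x) y = cinner x (B y)"
  shows "adjoint_op A = B"
  unfolding adjoint_op_def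
proof (rule the_equality)
  fix C assume C: "\<forall>x y. cinner (A x) y = cinner x (blinfun_apply C y)"
  show "C = B"
  proof (rule blinfun_eqI)
    fix y
    have "\<forall>x. inner x (C y) = inner x (B y)"
      using C assms by (simp add: inner_eq_Re_cinner)
    then show "C y = B y" by (simp only: vector_eq_ldot)
  qed
qed (use assms in blast)

lemma cinner_adjoint_op:
  fixes A :: "'a::complex_hilbert_space \<Rightarrow>\<^sub>L 'a"
  assumes A: "complex_linear A"
  shows "cinner (A x) y = cinner x (adjoint_op A y)"
proof -
  have "\<exists>b. \<forall>x. inner (A x) y = inner b x" for y
  proof -
    have "bounded_linear (\<lambda>x. inner (A x) y)"
      by (intro bounded_linear_compose[OF bounded_linear_inner_left] blinfun.bounded_linear_right)
    then obtain b where "\<And>x. inner (A x) y = inner b x" by (rule riesz_representation) blast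
    then show ?thesis by blast
  qed
  then obtain B where "\<And>x y. inner (A x) y = inner (B y) x" by metis
  then have B: "inner (A x) y = inner x (B y)" for x y by (simp only: inner_commute[of x])
  have eqI: "u = v" if "\<And>x. inner x u = inner x v" for u v :: 'a
    using that vector_eq_ldot by blast
  have "bounded_linear B"
  proof (rule bounded_linear_intro[where K = "norm A"])
    show "B (x + y) = B x + B y" for x y by (rule eqI) (simp add: inner_simps flip: B)
    show "B (s *\<^sub>R x) = s *\<^sub>R B x" for s x by (rule eqI) (simp add: inner_simps flip: B)
    fix y
    have "(norm (B y))\<^sup>2 = inner (A (B y)) y" by (simp add: B power2_norm_eq_inner)
    also have "\<dots> \<le> norm (A (B y)) * norm y" by (rule norm_cauchy_schwarz)
    also have "\<dots> \<le> norm A * norm (B y) * norm y" by (intro mult_right_mono norm_blinfun) simp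
    finally show "norm (B y) \<le> norm y * norm A"
      by (cases "B y = 0") (auto simp: power2_eq_square mult_ac)
  qed
  then have app: "blinfun_apply (Blinfun B) = B" by (rule bounded_linear_Blinfun_apply)
  have cB: "cinner (A x) y = cinner x (B y)" for x y
  proof (rule complex_eqI)
    show "Re (cinner (A x) y) = Re (cinner x (B y))"
      using B[of x y] by (simp add: inner_eq_Re_cinner)
    show "Im (cinner (A x) y) = Im (cinner x (B y))"
      using B[of "\<i> *\<^sub>C x" y] A by (simp add: inner_eq_Re_cinner complex_linear_def cinner_scaleC_left)
  qed
  then have "adjoint_op A = Blinfun B" by (intro adjoint_op_eqI) (simp add: app)
  with cB show ?thesis by (simp add: app)
qed

lemma positive_op_adjoint_compose:
  assumes A: "complex_linear A"
  shows "positive_op (adjoint_op A o\<^sub>L A)"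
proof -
  have r: "cinner (adjoint_op A y) x = cinner y (A x)" for x y
    using cinner_adjoint_op[OF A, of x y] cinner_commute[of "adjoint_op A y" x]
      cinner_commute[of y "A x"] by simp
  have "inner ((adjoint_op A o\<^sub>L A) x) x = (norm (A x))\<^sup>2" for x
    by (simp add: r inner_eq_Re_cinner power2_norm_eq_inner)
  then show ?thesis
    by (simp add: positive_op_def selfadjoint_def r cinner_adjoint_op[OF A, symmetric])
qed

lemma positive_op_abs_op: "complex_linear A \<Longrightarrow> positive_op (abs_op A)"
  unfolding abs_op_def by (intro positive_op_pow_op positive_op_adjoint_compose) auto

lemma abs_op_block_offdiag:
  assumes A: "complex_linear A1" "complex_linear A2"
  shows "abs_op (block_op 0 A1 A2 0) = block_op (abs_op A2) 0 0 (abs_op A1)"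
proof -
  have "adjoint_op (block_op 0 A1 A2 0) = block_op 0 (adjoint_op A2) (adjoint_op A1) 0"
    by (rule adjoint_op_eqI)
      (simp add: block_op_apply cinner_prod_def cinner_adjoint_op[OF A(1)] cinner_adjoint_op[OF A(2)])
  then have "adjoint_op (block_op 0 A1 A2 0) o\<^sub>L block_op 0 A1 A2 0
      = block_op (adjoint_op A2 o\<^sub>L A2) 0 0 (adjoint_op A1 o\<^sub>L A1)"
    by (intro blinfun_eqI) (simp add: block_op_apply)
  then show ?thesis
    unfolding abs_op_def by (simp add: pow_op_block_diag positive_op_adjoint_compose A)
qed

lemma norm_block_offdiag_le: "norm (block_op 0 X Y 0) \<le> max (norm X) (norm Y)"
proof (rule norm_blinfun_bound)
  define m where "m = max (norm X) (norm Y)"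
  have m: "m \<ge> 0" by (simp add: m_def le_max_iff_disj)
  fix z
  have "(norm (X (snd z)))\<^sup>2 \<le> (m * norm (snd z))\<^sup>2" "(norm (Y (fst z)))\<^sup>2 \<le> (m * norm (fst z))\<^sup>2"
    by (intro power_mono order_trans[OF norm_blinfun] mult_right_mono; simp add: m_def)+
  then have "(norm (block_op 0 X Y 0 z))\<^sup>2 \<le> (m * norm z)\<^sup>2"
    by (simp add: block_op_apply norm_prod_def power_mult_distrib distrib_left)
  then show "norm (block_op 0 X Y 0 z) \<le> m * norm z"
    by (rule power2_le_imp_le) (use m in simp)
qed (simp add: le_max_iff_disj)

lemma inner_block_diag_le: "inner (block_op S 0 0 T z) z \<le> max (norm S) (norm T) * (norm z)\<^sup>2"
proof -
  have *: "inner (R x) x \<le> m * (norm x)\<^sup>2" if "norm R \<le> m"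
    for R :: "'a \<Rightarrow>\<^sub>L 'a" and x m
  proof -
    have "inner (R x) x \<le> norm (R x) * norm x" by (rule norm_cauchy_schwarz)
    also have "\<dots> \<le> m * norm x * norm x"
      using norm_blinfun[of R x] mult_right_mono[OF that, of "norm x"]
      by (intro mult_right_mono) auto
    finally show ?thesis by (simp add: power2_eq_square mult.assoc)
  qed
  have "inner (block_op S 0 0 T z) z = inner (S (fst z)) (fst z) + inner (T (snd z)) (snd z)"
    by (simp add: block_op_apply inner_prod_def)
  also have "\<dots> \<le> max (norm S) (norm T) * (norm (fst z))\<^sup>2 + max (norm S) (norm T) * (norm (snd z))\<^sup>2"
    by (intro add_mono *) auto
  finally show ?thesis by (simp add: norm_prod_def distrib_left)
qed

section \<open>The numerical radius bound\<close>

lemma numerical_radius_bounds: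
  fixes A :: "'a::complex_hilbert_space \<Rightarrow>\<^sub>L 'a"
  assumes "0 \<le> C" "\<And>x. norm x = 1 \<Longrightarrow> cmod (cinner (A x) x) \<le> C"
  shows "0 \<le> numerical_radius A" "numerical_radius A \<le> C"
proof -
  let ?V = "insert 0 {cmod (cinner (A x) x) | x. norm x = 1}"
  have le: "v \<le> C" if "v \<in> ?V" for v
  proof -
    from that consider "v = 0" | x where "norm x = 1" "v = cmod (cinner (A x) x)" by blast
    then show ?thesis using assms by cases simp_all
  qed
  show "numerical_radius A \<le> C"
    unfolding numerical_radius_def by (rule cSup_least[OF insert_not_empty]) (rule le)
  show "0 \<le> numerical_radius A"
    unfolding numerical_radius_def by (rule cSup_upper[OF insertI1 bdd_aboveI[of _ C]]) (rule le)
qed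

lemma powr_numerical_radius_le:
  fixes A :: "'a::complex_hilbert_space \<Rightarrow>\<^sub>L 'a"
  assumes r: "r > 0" and C: "0 \<le> C"
    and le: "\<And>x. norm x = 1 \<Longrightarrow> cmod (cinner (A x) x) powr r \<le> C"
  shows "numerical_radius A powr r \<le> C"
proof -
  have "cmod (cinner (A x) x) \<le> C powr (1 / r)" if "norm x = 1" for x
    using powr_mono2[OF _ _ le[OF that], of "1 / r"] r by (simp add: powr_powr)
  note b = numerical_radius_bounds[OF _ this]
  have "numerical_radius A powr r \<le> (C powr (1 / r)) powr r"
    by (intro powr_mono2 b) (use r in auto)
  then show ?thesis using r C by (simp add: powr_powr)
qed

lemma rpow_max:
  assumes "s \<ge> 0" "a \<ge> 0" "b \<ge> 0"
  shows "rpow (max a b) s = max (rpow a s) (rpow b s)"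
proof (cases "a \<le> b")
  case True
  with assms have "rpow a s \<le> rpow b s" by (simp add: rpow_def powr_mono2)
  with True show ?thesis by (simp add: max_absorb2)
next
  case False
  with assms have "rpow b s \<le> rpow a s" by (simp add: rpow_def powr_mono2)
  with False show ?thesis by (simp add: max_absorb1)
qed

lemma cinner_sandwich_powr_le:
  assumes S: "positive_op S" and T: "positive_op T"
    and \<alpha>: "0 < \<alpha>" "\<alpha> \<le> 1" and pq: "r \<ge> 1" "p > 1" "q > 1" "1 / p + 1 / q = 1" "p * r \<ge> 2" "q * r \<ge> 2"
    and x: "norm x = 1"
  shows "cmod (cinner ((pow_op S \<alpha> o\<^sub>L Y o\<^sub>L pow_op T \<alpha>) x) x) powr r
    \<le> norm Y powr r
      * inner (((1 / p) *\<^sub>R pow_op S (p * r) + (1 / q) *\<^sub>R pow_op T (q * r)) x) x powr \<alpha>"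
proof -
  define a where "a = inner (pow_op S (p * r) x) x"
  define b where "b = inner (pow_op T (q * r) x) x"
  have nn: "a \<ge> 0" "b \<ge> 0"
    unfolding a_def b_def by (intro inner_pow_op_nonneg S T; use pq in simp)+
  have key: "norm (pow_op R \<alpha> x) powr r \<le> (inner (pow_op R (k * r) x) x powr (1 / k)) powr \<alpha>"
    if R: "positive_op R" and k: "k > 1" "k * r \<ge> 2" for R k
  proof -
    have "norm (pow_op R \<alpha> x) powr (k * r / \<alpha>) \<le> inner (pow_op R (k * r) x) x"
      by (rule norm_pow_op_powr_le[OF R]) (use \<alpha> k x in auto)
    then have "(norm (pow_op R \<alpha> x) powr (k * r / \<alpha>)) powr (\<alpha> / k)
        \<le> inner (pow_op R (k * r) x) x powr (\<alpha> / k)"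
      by (intro powr_mono2) (use \<alpha> k in auto)
    then show ?thesis using \<alpha> k by (simp add: powr_powr)
  qed
  have "selfadjoint (pow_op S \<alpha>)"
    using positive_op_pow_op[OF S] \<alpha> by (simp add: positive_op_def)
  then have "cinner ((pow_op S \<alpha> o\<^sub>L Y o\<^sub>L pow_op T \<alpha>) x) x = cinner (Y (pow_op T \<alpha> x)) (pow_op S \<alpha> x)"
    by (simp add: selfadjoint_def)
  also have "cmod \<dots> \<le> norm (Y (pow_op T \<alpha> x)) * norm (pow_op S \<alpha> x)" by (rule cmod_cinner_le)
  also have "\<dots> \<le> norm Y * norm (pow_op T \<alpha> x) * norm (pow_op S \<alpha> x)"
    by (intro mult_right_mono norm_blinfun) simp
  finally have "cmod (cinner ((pow_op S \<alpha> o\<^sub>L Y o\<^sub>L pow_op T \<alpha>) x) x) powr r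
      \<le> (norm Y * norm (pow_op T \<alpha> x) * norm (pow_op S \<alpha> x)) powr r"
    by (rule powr_mono2[rotated 2]) (use pq in auto)
  also have "\<dots> = norm Y powr r * (norm (pow_op S \<alpha> x) powr r * norm (pow_op T \<alpha> x) powr r)"
    by (simp add: powr_mult mult_ac)
  also have "\<dots> \<le> norm Y powr r * ((a powr (1 / p)) powr \<alpha> * (b powr (1 / q)) powr \<alpha>)"
    unfolding a_def b_def by (intro mult_left_mono mult_mono key S T) (use pq in auto)
  also have "\<dots> = norm Y powr r * (a powr (1 / p) * b powr (1 / q)) powr \<alpha>"
    by (simp add: powr_mult)
  also have "\<dots> \<le> norm Y powr r * (a / p + b / q) powr \<alpha>"
  proof -
    have "a powr (1 / p) * b powr (1 / q) \<le> (a powr (1 / p)) powr p / p + (b powr (1 / q)) powr q / q"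
      by (rule Youngs_inequality) (use pq in auto)
    also have "\<dots> = a / p + b / q" using pq nn by (simp add: powr_powr)
    finally show ?thesis using \<alpha> by (intro mult_left_mono powr_mono2) auto
  qed
  finally show ?thesis
    by (simp add: a_def b_def blinfun.bilinear_simps inner_simps)
qed

theorem theorem3p35:
  fixes A1 A2 B1 B2 X1 X2 :: "'h::complex_hilbert_space \<Rightarrow>\<^sub>L 'h"
    and \<alpha> r p q :: real
  assumes "complex_linear A1" "complex_linear A2"
    and "complex_linear B1" "complex_linear B2"
    and "complex_linear X1" "complex_linear X2"
    and "0 \<le> \<alpha>" "\<alpha> \<le> 1"
    and "r \<ge> 1" "p \<ge> 1" "q \<ge> 1"
    and "1 / p + 1 / q = 1"
    and "p * r \<ge> 2" "q * r \<ge> 2"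
  shows "rpow (numerical_radius
            (pow_op (abs_op (block_op 0 A1 A2 0)) \<alpha> o\<^sub>L block_op 0 X1 X2 0
               o\<^sub>L pow_op (abs_op (block_op 0 B1 B2 0)) \<alpha>)) r
    \<le> max (rpow (norm X1) r) (rpow (norm X2) r)
       * max (rpow (norm ((1 / p) *\<^sub>R pow_op (abs_op A1) (p * r)
                           + (1 / q) *\<^sub>R pow_op (abs_op B1) (q * r))) \<alpha>)
             (rpow (norm ((1 / p) *\<^sub>R pow_op (abs_op A2) (p * r)
                           + (1 / q) *\<^sub>R pow_op (abs_op B2) (q * r))) \<alpha>)"
proof -
  have pq: "p > 1" "q > 1"
  proof -
    have "1 / q > 0" "1 / p > 0" using assms by auto
    then have "1 / p < 1" "1 / q < 1" using assms(12) by linarith+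
    then show "p > 1" "q > 1" using assms by (auto simp: divide_less_eq)
  qed
  define S where "S = abs_op (block_op 0 A1 A2 0)"
  define T where "T = abs_op (block_op 0 B1 B2 0)"
  define Y where "Y = block_op 0 X1 X2 0"
  define D1 where "D1 = (1 / p) *\<^sub>R pow_op (abs_op A1) (p * r) + (1 / q) *\<^sub>R pow_op (abs_op B1) (q * r)"
  define D2 where "D2 = (1 / p) *\<^sub>R pow_op (abs_op A2) (p * r) + (1 / q) *\<^sub>R pow_op (abs_op B2) (q * r)"
  have S: "S = block_op (abs_op A2) 0 0 (abs_op A1)" and T: "T = block_op (abs_op B2) 0 0 (abs_op B1)"
    unfolding S_def T_def by (intro abs_op_block_offdiag assms)+
  have pos: "positive_op S" "positive_op T"
    unfolding S T by (intro positive_op_block_diag positive_op_abs_op assms)+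
  define C where "C = norm Y powr r * rpow (max (norm D1) (norm D2)) \<alpha>"
  have D: "(1 / p) *\<^sub>R pow_op S (p * r) + (1 / q) *\<^sub>R pow_op T (q * r) = block_op D2 0 0 D1"
  proof -
    have "pow_op S (p * r) = block_op (pow_op (abs_op A2) (p * r)) 0 0 (pow_op (abs_op A1) (p * r))"
      "pow_op T (q * r) = block_op (pow_op (abs_op B2) (q * r)) 0 0 (pow_op (abs_op B1) (q * r))"
      unfolding S T by (intro pow_op_block_diag positive_op_abs_op assms; use assms in simp)+
    then show ?thesis
      by (intro blinfun_eqI)
        (simp add: D1_def D2_def block_op_apply blinfun.bilinear_simps prod_eq_iff)
  qed
  have "cmod (cinner ((pow_op S \<alpha> o\<^sub>L Y o\<^sub>L pow_op T \<alpha>) x) x) powr r \<le> C" if x: "norm x = 1" for x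
  proof (cases "\<alpha> = 0")
    case True
    have "cmod (cinner (Y x) x) \<le> norm Y"
      using cmod_cinner_le[of "Y x" x] norm_blinfun[of Y x] x by simp
    then have "cmod (cinner (Y x) x) powr r \<le> norm Y powr r"
      by (intro powr_mono2) (use assms in auto)
    then show ?thesis using True by (simp add: pow_op_0 pos C_def rpow_def)
  next
    case False
    let ?D = "(1 / p) *\<^sub>R pow_op S (p * r) + (1 / q) *\<^sub>R pow_op T (q * r)"
    have "0 \<le> inner (pow_op S (p * r) x) x" "0 \<le> inner (pow_op T (q * r) x) x"
      by (intro inner_pow_op_nonneg pos; use assms in simp)+
    then have "0 \<le> inner (?D x) x"
      using assms by (simp add: blinfun.bilinear_simps inner_simps)
    moreover have "inner (?D x) x \<le> max (norm D1) (norm D2)"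
      using inner_block_diag_le[of D2 D1 x] x unfolding D by (simp add: max.commute)
    ultimately have "inner (?D x) x powr \<alpha> \<le> rpow (max (norm D1) (norm D2)) \<alpha>"
      using False assms by (simp add: rpow_def powr_mono2)
    then have "norm Y powr r * inner (?D x) x powr \<alpha> \<le> C"
      unfolding C_def by (rule mult_left_mono) simp
    with cinner_sandwich_powr_le[OF pos _ assms(8,9) pq assms(12-14) x, of Y] False assms(7)
    show ?thesis by fastforce
  qed
  then have "numerical_radius (pow_op S \<alpha> o\<^sub>L Y o\<^sub>L pow_op T \<alpha>) powr r \<le> C"
    by (intro powr_numerical_radius_le) (use assms in \<open>auto simp: C_def rpow_nonneg\<close>)
  also have "C \<le> rpow (max (norm X1) (norm X2)) r * rpow (max (norm D1) (norm D2)) \<alpha>"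
    unfolding C_def rpow_def[of _ r] Y_def using assms
    by (auto intro!: mult_right_mono powr_mono2 norm_block_offdiag_le rpow_nonneg)
  finally show ?thesis
    using assms
    by (simp add: S_def[symmetric] T_def[symmetric] Y_def[symmetric] D1_def[symmetric]
        D2_def[symmetric] rpow_max rpow_def[of "numerical_radius _"])
qed

end
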